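(* Let $k\ge 2$ and let $S$ be an arbitrary subset of $\mathbf{N}$. Then the set of ordered $k$-tuples $(n_1,\dots,n_k)\in\mathbf{N}^k$ with $\operatorname{gcud}(n_1,\dots,n_k)\in S$ has asymptotic density $$\delta_k(S)=\sum_{n=1}^{\infty}\frac{\mu^*_S(n)\,\phi^k(n)}{n^{2k}},$$ and the set of ordered $k$-tuples with $\operatorname{gcud}(n_1,\dots,n_k)=1$ has asymptotic density $$\delta_k=\prod_p\Bigl(1-\frac{(p-1)^k}{p^k(p^k-1)}\Bigr),$$ the product being over all primes. Here the asymptotic density of $A\subseteq\mathbf{N}^k$ means $\lim_{x\to\infty}x^{-k}\#(A\cap[1,x]^k)$.
   Context: For $d,n\in\mathbf{N}$, $d$ is a unitary divisor of $n$, written $d\| n$, if $d\mid n$ and $\gcd(d,n/d)=1$. $\operatorname{gcud}(n_1,\dots,n_k)$ denotes the greatest common unitary divisor of $n_1,\dots,n_k$. For $S\subseteq\mathbf{N}$, $\rho_S$ is its characteristic function, and $\mu^*_S$ is defined by $\sum_{d\| n}\mu^*_S(d)=\rho_S(n)$ for all $n\in\mathbf{N}$, i.e. $\mu^*_S(n)=\sum_{d\| n}\rho_S(d)(-1)^{\omega(n/d)}$ with $\omega(m)$ the number of distinct prime factors of $m$. $\phi$ is Euler's totient function. *)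

theory Defs
  imports "HOL-Analysis.Analysis" "HOL-Number_Theory.Totient"
begin

definition unitary_dvd :: "nat \<Rightarrow> nat \<Rightarrow> bool" (infix \<open>udvd\<close> 50)
  where "d udvd n \<longleftrightarrow> d dvd n \<and> coprime d (n div d)"

(* Only meaningful for nonempty lists of positive integers. *)
definition gcud :: "nat list \<Rightarrow> nat"
  where "gcud ns = Max {d. \<forall>n\<in>set ns. d udvd n}"

definition char_fun :: "nat set \<Rightarrow> nat \<Rightarrow> real"
  where "char_fun S n = (if n \<in> S then 1 else 0)"

definition omega :: "nat \<Rightarrow> nat"
  where "omega n = card (prime_factors n)"

(* The explicit formula; mu_star_sum and mu_star_unique below show that on the
   positive integers it is the unique solution of the defining identity. *)
definition mu_star :: "nat set \<Rightarrow> nat \<Rightarrow> real"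
  where "mu_star S n = (\<Sum>d | d udvd n. char_fun S d * (-1) ^ omega (n div d))"

definition pos_tuples :: "nat \<Rightarrow> nat list set"
  where "pos_tuples k = {ns. length ns = k \<and> (\<forall>n\<in>set ns. 0 < n)}"

definition has_asymp_density :: "nat \<Rightarrow> nat list set \<Rightarrow> real \<Rightarrow> bool"
  where "has_asymp_density k A \<delta> \<longleftrightarrow>
    ((\<lambda>x::real. real (card {ns \<in> A \<inter> pos_tuples k. \<forall>n\<in>set ns. real n \<le> x}) / x ^ k) \<longlongrightarrow> \<delta>) at_top"

lemma udvd_iff:
  assumes "0 < n"
  shows "d udvd n \<longleftrightarrow> (\<exists>g. n = d * g \<and> coprime d g)"
  using assms unfolding unitary_dvd_def by (auto elim!: dvdE)

lemma finite_udvd: "0 < n \<Longrightarrow> finite {d. d udvd n}"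
  by (rule finite_subset[of _ "{d. d dvd n}"]) (auto simp: unitary_dvd_def)

lemma udvd_refl: "0 < n \<Longrightarrow> n udvd n"
  by (simp add: unitary_dvd_def)

lemma udvd_le: "0 < n \<Longrightarrow> d udvd n \<Longrightarrow> 0 < d \<and> d \<le> n"
  by (auto simp: unitary_dvd_def dvd_imp_le dest: dvd_pos_nat)

lemma udvd_prime_power_mult:
  assumes "prime p" "\<not> p dvd r" "0 < r" "0 < a"
  shows "{d. d udvd p ^ a * r} = {d. d udvd r} \<union> (*) (p ^ a) ` {d. d udvd r}"
proof (intro equalityI subsetI)
  have pos: "0 < p ^ a * r" using assms prime_gt_0_nat by simp
  have cop: "coprime (p ^ a) r"
    using assms by (simp add: prime_imp_coprime)
  {
    fix d
    assume "d \<in> {d. d udvd p ^ a * r}"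
    then obtain g where g: "p ^ a * r = d * g" "coprime d g"
      using udvd_iff[OF pos] by auto
    have "p dvd p ^ a" using assms(4) by (simp add: dvd_power)
    then have "p dvd d * g" by (metis dvd_mult2 g(1))
    then consider "p dvd d" "\<not> p dvd g" | "p dvd g" "\<not> p dvd d"
      using assms(1) g(2) by (metis coprime_common_divisor not_prime_unit prime_dvd_mult_iff)
    then show "d \<in> {d. d udvd r} \<union> (*) (p ^ a) ` {d. d udvd r}"
    proof cases
      case 1
      then have "coprime (p ^ a) g" using assms(1) by (simp add: prime_imp_coprime)
      then have "p ^ a dvd d" by (metis coprime_dvd_mult_left_iff dvd_triv_left g(1))
      then obtain e where e: "d = p ^ a * e" by (elim dvdE)
      then have "r = e * g" using g(1) assms(1) by simp
      moreover have "coprime e g" using g(2) e by simp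
      ultimately have "e udvd r" using udvd_iff[OF assms(3)] by auto
      then show ?thesis using e by auto
    next
      case 2
      then have "coprime (p ^ a) d" using assms(1) by (simp add: prime_imp_coprime)
      then have "p ^ a dvd g" by (metis coprime_dvd_mult_right_iff dvd_triv_left g(1))
      then obtain e where e: "g = p ^ a * e" by (elim dvdE)
      then have "r = d * e" using g(1) assms(1) by simp
      moreover have "coprime d e" using g(2) e by simp
      ultimately have "d udvd r" using udvd_iff[OF assms(3)] by auto
      then show ?thesis by auto
    qed
  }
  fix d
  assume "d \<in> {d. d udvd r} \<union> (*) (p ^ a) ` {d. d udvd r}"
  then obtain e where e: "e udvd r" "d = e \<or> d = p ^ a * e" by auto
  obtain g where g: "r = e * g" "coprime e g" using e(1) udvd_iff[OF assms(3)] by auto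
  have c: "coprime (p ^ a) e" "coprime (p ^ a) g" using cop g(1) by auto
  show "d \<in> {d. d udvd p ^ a * r}"
    using e(2)
  proof
    assume "d = e"
    then show ?thesis unfolding mem_Collect_eq udvd_iff[OF pos]
      using g c by (intro exI[of _ "p ^ a * g"]) (simp add: coprime_commute)
  next
    assume "d = p ^ a * e"
    then show ?thesis unfolding mem_Collect_eq udvd_iff[OF pos]
      using g c by (intro exI[of _ g]) simp
  qed
qed

lemma omega_prime_power_mult:
  assumes "prime p" "\<not> p dvd d" "0 < d" "0 < a"
  shows "omega (p ^ a * d) = Suc (omega d)"
proof -
  have "prime_factors (p ^ a * d) = insert p (prime_factors d)"
    using assms by (simp add: prime_factors_product prime_factors_power prime_prime_factors)
  then show ?thesis using assms(2) by (simp add: omega_def in_prime_factors_iff)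
qed

lemma sum_udvd_omega:
  assumes "0 < m"
  shows "(\<Sum>d | d udvd m. (-1::real) ^ omega d) = (if m = 1 then 1 else 0)"
proof (cases "m = 1")
  case True
  have "{d. d udvd 1} = {1}" by (auto simp: unitary_dvd_def)
  then show ?thesis using True by (simp add: omega_def)
next
  case False
  then obtain p where p: "prime p" "p dvd m" using prime_factor_nat by blast
  obtain r where r: "m = p ^ multiplicity p m * r" "\<not> p dvd r"
    using multiplicity_decompose'[of m p] assms p(1) not_prime_unit by blast
  define a where "a = multiplicity p m"
  have a: "0 < a" using p assms by (simp add: a_def prime_multiplicity_gt_zero_iff)
  have r0: "0 < r" using assms r(1) by (cases r) auto
  let ?U = "{d. d udvd r}"
  have npd: "\<not> p dvd d \<and> 0 < d" if "d \<in> ?U" for d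
    using that r(2) r0 udvd_le[OF r0] by (auto simp: unitary_dvd_def dest: dvd_trans)
  have "(\<Sum>d | d udvd m. (-1::real) ^ omega d)
      = (\<Sum>d\<in>?U \<union> (*) (p ^ a) ` ?U. (-1) ^ omega d)"
    using udvd_prime_power_mult[OF p(1) r(2) r0 a] r(1) by (simp add: a_def)
  also have "\<dots> = (\<Sum>d\<in>?U. (-1) ^ omega d) + (\<Sum>d\<in>(*) (p ^ a) ` ?U. (-1) ^ omega d)"
  proof (rule sum.union_disjoint)
    show "?U \<inter> (*) (p ^ a) ` ?U = {}"
    proof -
      have "p dvd p ^ a * e" for e using a by (simp add: dvd_mult2 dvd_power)
      then show ?thesis using npd by blast
    qed
  qed (use finite_udvd[OF r0] in auto)
  also have "(\<Sum>d\<in>(*) (p ^ a) ` ?U. (-1::real) ^ omega d) = (\<Sum>d\<in>?U. (-1) ^ omega (p ^ a * d))"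
    using p(1) by (subst sum.reindex) (auto simp: inj_on_def)
  also have "\<dots> = (\<Sum>d\<in>?U. - ((-1) ^ omega d))"
    by (rule sum.cong) (use npd p(1) a in \<open>auto simp: omega_prime_power_mult\<close>)
  finally show ?thesis using False by (simp add: sum_negf)
qed

lemma mu_star_sum:
  assumes "0 < n"
  shows "(\<Sum>d | d udvd n. mu_star S d) = char_fun S n"
proof -
  have pos: "0 < d" if "d udvd n" for d using udvd_le[OF assms that] by simp
  have pos': "0 < n div e" if "e udvd n" for e using udvd_le[OF assms that] by (simp add: div_greater_zero_iff)
  have "(\<Sum>d | d udvd n. mu_star S d)
      = (\<Sum>(d, e)\<in>(SIGMA d:{d. d udvd n}. {e. e udvd d}). char_fun S e * (-1) ^ omega (d div e))"
    unfolding mu_star_def using finite_udvd assms pos by (subst sum.Sigma) auto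
  also have "\<dots> = (\<Sum>(e, f)\<in>(SIGMA e:{e. e udvd n}. {f. f udvd n div e}). char_fun S e * (-1) ^ omega f)"
  proof (rule sum.reindex_bij_witness[of _ "\<lambda>(e, f). (e * f, e)" "\<lambda>(d, e). (e, d div e)"])
    fix x assume "x \<in> (SIGMA d:{d. d udvd n}. {e. e udvd d})"
    then obtain d e where x: "x = (d, e)" "d udvd n" "e udvd d" by auto
    obtain g where g: "n = d * g" "coprime d g" using x(2) udvd_iff[OF assms] by auto
    obtain f where f: "d = e * f" "coprime e f" using x(3) udvd_iff[OF pos[OF x(2)]] by auto
    have e0: "0 < e" using f(1) pos[OF x(2)] by (cases e) auto
    have "e udvd n" unfolding udvd_iff[OF assms]
      using g f by (intro exI[of _ "f * g"]) auto
    moreover have "f udvd n div e"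
      using g f e0 udvd_iff[OF pos'[OF calculation]] by auto
    ultimately show "(case x of (d, e) \<Rightarrow> (e, d div e)) \<in> (SIGMA e:{e. e udvd n}. {f. f udvd n div e})"
      using x f e0 by auto
    show "(case (case x of (d, e) \<Rightarrow> (e, d div e)) of (e, f) \<Rightarrow> (e * f, e)) = x"
      using x f e0 by auto
  next
    fix y assume "y \<in> (SIGMA e:{e. e udvd n}. {f. f udvd n div e})"
    then obtain e f where y: "y = (e, f)" "e udvd n" "f udvd n div e" by auto
    obtain h where h: "n = e * h" "coprime e h" using y(2) udvd_iff[OF assms] by auto
    have e0: "0 < e" using pos y(2) by blast
    obtain g where g: "h = f * g" "coprime f g"
      using y(3) udvd_iff[OF pos'[OF y(2)]] h e0 by auto
    have "e * f udvd n" unfolding udvd_iff[OF assms]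
      using g h by (intro exI[of _ g]) auto
    moreover have "e udvd e * f"
      using udvd_iff[OF pos[OF calculation]] g h by auto
    ultimately show "(case y of (e, f) \<Rightarrow> (e * f, e)) \<in> (SIGMA d:{d. d udvd n}. {e. e udvd d})"
      using y by auto
    show "(case (case y of (e, f) \<Rightarrow> (e * f, e)) of (d, e) \<Rightarrow> (e, d div e)) = y"
      using y e0 by auto
  qed auto
  also have "\<dots> = (\<Sum>e | e udvd n. \<Sum>f | f udvd n div e. char_fun S e * (-1) ^ omega f)"
    using finite_udvd assms pos' by (subst sum.Sigma) auto
  also have "\<dots> = (\<Sum>e | e udvd n. if e = n then char_fun S e else 0)"
  proof (rule sum.cong)
    fix e assume "e \<in> {e. e udvd n}"
    then have e: "e udvd n" by simp
    have "n div e = 1 \<longleftrightarrow> e = n"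
      using e assms unfolding unitary_dvd_def by (auto elim!: dvdE)
    then show "(\<Sum>f | f udvd n div e. char_fun S e * (-1) ^ omega f) = (if e = n then char_fun S e else 0)"
      using sum_udvd_omega[OF pos'[OF e]] by (simp add: sum_distrib_left[symmetric])
  qed simp
  also have "\<dots> = char_fun S n"
    using finite_udvd[OF assms] udvd_refl[OF assms] by (simp add: sum.delta)
  finally show ?thesis .
qed

lemma mu_star_unique:
  assumes f: "\<And>n. 0 < n \<Longrightarrow> (\<Sum>d | d udvd n. f d) = char_fun S n" and "0 < n"
  shows "f n = mu_star S n"
  using assms(2)
proof (induction n rule: less_induct)
  case (less n)
  have split: "(\<Sum>d | d udvd n. h d) = h n + (\<Sum>d\<in>{d. d udvd n} - {n}. h d)" for h :: "nat \<Rightarrow> real"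
    using finite_udvd[OF less.prems] udvd_refl[OF less.prems] by (subst sum.remove[of _ n]) auto
  have "(\<Sum>d\<in>{d. d udvd n} - {n}. f d) = (\<Sum>d\<in>{d. d udvd n} - {n}. mu_star S d)"
  proof (rule sum.cong)
    fix d assume d: "d \<in> {d. d udvd n} - {n}"
    then have "0 < d" "d < n" using udvd_le[OF less.prems, of d] by auto
    then show "f d = mu_star S d" using less.IH by blast
  qed simp
  then show ?case
    using f[OF less.prems] mu_star_sum[OF less.prems, of S] split[of f] split[of "mu_star S"] by simp
qed

end

(* A number is a common unitary divisor of a tuple iff it is a unitary divisor of its gcud.  So the
   number of tuples in [1,x]^k with gcud in S is the sum over d of mu_star S d * u(x,d)^k, where u(x,d)
   counts the n <= x with d a unitary divisor of n.  Writing n = d * m with m coprime to d gives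
   u(x,d) / x -> totient d / d^2 and u(x,d) / x <= 1 / d.  Since |mu_star S d| is at most the number of
   divisors of d, hence at most 2 * sqrt d, the terms are dominated by 2 * d^(-3/2) and the limit may
   be taken termwise (Tannery).  For S = {1} the function mu_star S is multiplicative, and the series
   has an Euler product. *)
theory Submission
  imports Defs "HOL-Library.Discrete_Functions"
begin

section \<open>Greatest common unitary divisors\<close>

lemma udvd_trans:
  assumes "0 < n" "d udvd m" "m udvd n"
  shows "d udvd n"
proof -
  obtain g where g: "n = m * g" "coprime m g" using assms udvd_iff by blast
  obtain h where h: "m = d * h" "coprime d h"
    using assms udvd_iff[of m d] udvd_le[of n m] by blast
  have "n = d * (h * g)" "coprime d (h * g)" using g h by auto
  then show ?thesis using assms(1) udvd_iff by blast
qed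

text \<open>The cofactor of \<open>d\<close> in \<open>m\<close> divides its cofactor in
  \<open>n\<close>, so it inherits coprimality with \<open>d\<close>.\<close>

lemma udvd_of_dvd:
  assumes "0 < n" "m udvd n" "d udvd n" "d dvd m"
  shows "d udvd m"
proof -
  obtain c where c: "n = d * c" "coprime d c" using assms udvd_iff by blast
  obtain h where h: "m = d * h" using assms by (elim dvdE)
  obtain g where g: "n = m * g" using assms udvd_iff by blast
  have "0 < d" using c assms(1) by (cases d) auto
  then have "c = h * g" using c h g by simp
  then have "coprime d h" using c by simp
  moreover have "0 < m" using udvd_le assms(1,2) by blast
  ultimately show ?thesis using h udvd_iff by blast
qed

text \<open>The cofactor \<open>g\<close> of the lcm divides the cofactors of both \<open>d\<close>
  and \<open>e\<close>, so it is coprime to \<open>d * e\<close> and hence to the lcm, which divides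
  that product.\<close>

lemma udvd_lcm:
  assumes "0 < n" "d udvd n" "e udvd n"
  shows "lcm d e udvd n"
proof -
  obtain c where c: "n = d * c" "coprime d c" using assms udvd_iff by blast
  obtain b where b: "n = e * b" "coprime e b" using assms udvd_iff by blast
  have "lcm d e dvd n" using c b by (metis dvd_triv_left lcm_least)
  then obtain g where g: "n = lcm d e * g" by (elim dvdE)
  have pos: "0 < d" "0 < e" using assms udvd_le by auto
  obtain x y where x: "lcm d e = d * x" and y: "lcm d e = e * y"
    by (meson dvd_lcm1 dvd_lcm2 dvdE)
  have "c = x * g" "b = y * g" using c b g x y pos by (metis mult.assoc nat_mult_eq_cancel1)+
  then have "coprime d g" "coprime e g" using c b by auto
  then have "coprime (d * e) g" by simp
  moreover have "lcm d e dvd d * e" by (simp add: lcm_least)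
  ultimately have "coprime (lcm d e) g" using coprime_divisors dvd_refl by blast
  then show ?thesis using g assms(1) udvd_iff by blast
qed

lemma finite_common_udvd:
  assumes "ns \<noteq> []" "\<forall>n\<in>set ns. 0 < n"
  shows "finite {d. \<forall>n\<in>set ns. d udvd n}"
  by (rule finite_subset[OF _ finite_udvd[of "hd ns"]]) (use assms in auto)

lemma gcud_udvd:
  assumes "ns \<noteq> []" "\<forall>n\<in>set ns. 0 < n"
  shows "\<forall>n\<in>set ns. gcud ns udvd n"
proof -
  have "1 \<in> {d. \<forall>n\<in>set ns. d udvd n}" by (simp add: unitary_dvd_def)
  then show ?thesis unfolding gcud_def using Max_in[OF finite_common_udvd[OF assms]] by blast
qed

lemma gcud_pos:
  assumes "ns \<noteq> []" "\<forall>n\<in>set ns. 0 < n"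
  shows "0 < gcud ns"
  using gcud_udvd[OF assms] assms udvd_le by (cases ns) auto

text \<open>\<open>gcud\<close> is a maximum in size only; closure under lcm makes it a maximum for
  divisibility as well.\<close>

lemma udvd_gcud_iff:
  assumes "ns \<noteq> []" "\<forall>n\<in>set ns. 0 < n"
  shows "d udvd gcud ns \<longleftrightarrow> (\<forall>n\<in>set ns. d udvd n)"
proof -
  let ?C = "{d. \<forall>n\<in>set ns. d udvd n}"
  obtain n0 where n0: "n0 \<in> set ns" using assms(1) by (cases ns) auto
  note fin = finite_common_udvd[OF assms] and G = gcud_udvd[OF assms]
  show ?thesis
  proof
    assume "d udvd gcud ns"
    then show "\<forall>n\<in>set ns. d udvd n" using G assms(2) udvd_trans by blast
  next
    assume d: "\<forall>n\<in>set ns. d udvd n"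
    \<comment> \<open>This lcm is again a common unitary divisor, so maximality forces it to equal
      \<open>gcud ns\<close>, and \<open>d\<close> divides it.\<close>
    let ?l = "lcm d (gcud ns)"
    have "?l \<in> ?C" using d G assms(2) udvd_lcm by blast
    then have "?l \<le> gcud ns" unfolding gcud_def using Max_ge[OF fin] by blast
    moreover have "0 < ?l" using \<open>?l \<in> ?C\<close> n0 assms(2) udvd_le by blast
    ultimately have "?l = gcud ns" by (metis dvd_imp_le dvd_lcm2 le_antisym gr0I lcm_0_iff_nat neq0_conv)
    then have "d dvd gcud ns" by (metis dvd_lcm1)
    then show "d udvd gcud ns" using n0 G d assms(2) udvd_of_dvd by blast
  qed
qed

section \<open>Counting tuples by their common unitary divisors\<close>

definition udvd_count :: "nat \<Rightarrow> nat \<Rightarrow> nat"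
  where "udvd_count N d = card {n \<in> {1..N}. d udvd n}"

text \<open>Expand the indicator of \<open>S\<close> at the gcud as a sum of \<open>mu_star\<close>
  over common unitary divisors and exchange the sums. For fixed \<open>d\<close> the
  \<open>k\<close> entries are chosen independently, which gives the \<open>k\<close>-th power.
  Positive \<open>k\<close> keeps the tuples nonempty, so that their gcud makes sense.\<close>

lemma card_gcud_mem:
  assumes "0 < k"
  shows "real (card {ns. set ns \<subseteq> {1..N} \<and> length ns = k \<and> gcud ns \<in> S})
    = (\<Sum>d\<in>{1..N}. mu_star S d * real (udvd_count N d) ^ k)"
proof -
  let ?T = "{ns. set ns \<subseteq> {1..N} \<and> length ns = k}"
  have fin: "finite ?T" by (rule finite_lists_length_eq) simp
  have char: "char_fun S (gcud ns) = (\<Sum>d\<in>{1..N}. if \<forall>n\<in>set ns. d udvd n then mu_star S d else 0)"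
    if ns: "ns \<in> ?T" for ns
  proof -
    have ne: "ns \<noteq> []" and pos: "\<forall>n\<in>set ns. 0 < n" using ns assms by auto
    have "char_fun S (gcud ns) = (\<Sum>d | d udvd gcud ns. mu_star S d)"
      using mu_star_sum[OF gcud_pos[OF ne pos]] by simp
    also have "{d. d udvd gcud ns} = {d. \<forall>n\<in>set ns. d udvd n}"
      using udvd_gcud_iff[OF ne pos] by blast
    \<comment> \<open>The range of \<open>d\<close> is made independent of \<open>ns\<close>, so
      that the two sums can be swapped.\<close>
    also have "\<dots> = {d \<in> {1..N}. \<forall>n\<in>set ns. d udvd n}"
    proof (intro Collect_cong iffI conjI)
      fix d assume d: "\<forall>n\<in>set ns. d udvd n"
      obtain n where n: "n \<in> set ns" using ne by (cases ns) auto
      then have "0 < d \<and> d \<le> n" using udvd_le pos d by blast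
      moreover have "n \<le> N" using ns n by auto
      ultimately show "d \<in> {1..N}" by simp
    qed auto
    finally show ?thesis by (simp only: sum.inter_filter finite_atLeastAtMost)
  qed
  have "real (card {ns. set ns \<subseteq> {1..N} \<and> length ns = k \<and> gcud ns \<in> S})
      = (\<Sum>ns\<in>?T. char_fun S (gcud ns))"
    using fin by (simp add: char_fun_def sum.If_cases conj_assoc Int_def)
  also have "\<dots> = (\<Sum>ns\<in>?T. \<Sum>d\<in>{1..N}. if \<forall>n\<in>set ns. d udvd n then mu_star S d else 0)"
    by (rule sum.cong) (use char in auto)
  also have "\<dots> = (\<Sum>d\<in>{1..N}. \<Sum>ns\<in>?T. if \<forall>n\<in>set ns. d udvd n then mu_star S d else 0)"
    by (rule sum.swap)
  also have "\<dots> = (\<Sum>d\<in>{1..N}. mu_star S d * real (udvd_count N d) ^ k)"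
  proof (rule sum.cong)
    fix d
    have "{ns. set ns \<subseteq> {1..N} \<and> length ns = k \<and> (\<forall>n\<in>set ns. d udvd n)}
        = {ns. set ns \<subseteq> {n \<in> {1..N}. d udvd n} \<and> length ns = k}"
      unfolding subset_iff by blast
    then have "card {ns. set ns \<subseteq> {1..N} \<and> length ns = k \<and> (\<forall>n\<in>set ns. d udvd n)} = udvd_count N d ^ k"
      by (simp add: udvd_count_def card_lists_length_eq)
    then show "(\<Sum>ns\<in>?T. if \<forall>n\<in>set ns. d udvd n then mu_star S d else 0)
        = mu_star S d * real (udvd_count N d) ^ k"
      using fin by (simp add: sum.If_cases conj_assoc Int_def)
  qed simp
  finally show ?thesis .
qed

section \<open>Size and asymptotics of the count\<close>

text \<open>For these \<open>d\<close> the terms vanish, so a sum over \<open>{1..N}\<close> can be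
  treated as a series over all naturals.\<close>

lemma udvd_count_eq_0:
  assumes "d = 0 \<or> N < d"
  shows "udvd_count N d = 0"
proof -
  have "{n \<in> {1..N}. d udvd n} = {}" using assms udvd_le by (auto simp: Suc_le_eq) (meson leD le_trans not_less_zero)
  then show ?thesis unfolding udvd_count_def by (simp only: card.empty)
qed

lemma udvd_count_eq:
  assumes "0 < d"
  shows "udvd_count N d = card {m \<in> {1..N div d}. coprime m d}"
  unfolding udvd_count_def
proof (rule bij_betw_same_card[symmetric], rule bij_betwI[where f = "\<lambda>m. d * m" and g = "\<lambda>n. n div d"])
  show "(\<lambda>m. d * m) \<in> {m \<in> {1..N div d}. coprime m d} \<rightarrow> {n \<in> {1..N}. d udvd n}"
    using assms by (auto simp: unitary_dvd_def less_eq_div_iff_mult_less_eq ac_simps)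
  show "(\<lambda>n. n div d) \<in> {n \<in> {1..N}. d udvd n} \<rightarrow> {m \<in> {1..N div d}. coprime m d}"
    using assms by (auto simp: unitary_dvd_def div_le_mono ac_simps dvd_imp_le div_greater_zero_iff Suc_le_eq)
qed (use assms in \<open>auto simp: unitary_dvd_def\<close>)

lemma udvd_count_le: "real (udvd_count N d) * real d \<le> real N"
proof (cases "d = 0")
  case False
  have "card {m \<in> {1..N div d}. coprime m d} \<le> card {1..N div d}"
    by (rule card_mono) auto
  then have "udvd_count N d \<le> N div d" using False by (simp add: udvd_count_eq)
  then have "udvd_count N d * d \<le> N div d * d" by (rule mult_le_mono1)
  also have "\<dots> \<le> N" by (rule div_times_less_eq_dividend)
  finally show ?thesis by (metis of_nat_mult of_nat_le_iff)
qed simp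

text \<open>Coprimality to \<open>d\<close> is periodic with period \<open>d\<close>, and each full
  period contains \<open>totient d\<close> such numbers. Lowering \<open>N\<close> by
  \<open>d\<close> therefore leaves the difference inside the absolute value unchanged, and only an
  incomplete period contributes an error.\<close>

lemma card_coprime_approx:
  assumes "0 < d"
  shows "\<bar>real (card {m \<in> {1..N}. coprime m d}) * d - real N * totient d\<bar> \<le> real d * d"
proof (induction N rule: less_induct)
  case (less N)
  let ?C = "\<lambda>N. {m \<in> {1..N}. coprime m d}"
  show ?case
  proof (cases "N < d")
    case True
    \<comment> \<open>In an incomplete period both terms of the difference lie between 0 and
      \<open>d * d\<close>.\<close>
    have "card (?C N) \<le> card {1..N}" by (rule card_mono) auto
    then have "card (?C N) \<le> d" using True by simp
    then have "real (card (?C N)) * d \<le> real d * d" by (intro mult_right_mono) auto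
    moreover have "real N * totient d \<le> real d * d"
      using True totient_le[of d] by (intro mult_mono) auto
    ultimately show ?thesis by (simp add: abs_le_iff) (smt (verit) mult_nonneg_nonneg of_nat_0_le_iff)
  next
    case False
    \<comment> \<open>Split off the first period, \<open>1..d\<close>; the rest is a translate by
      \<open>d\<close> of the set for \<open>N - d\<close>.\<close>
    have "?C N = totatives d \<union> (\<lambda>m. m + d) ` ?C (N - d)"
    proof (intro equalityI subsetI)
      fix m assume m: "m \<in> ?C N"
      show "m \<in> totatives d \<union> (\<lambda>m. m + d) ` ?C (N - d)"
      proof (cases "m \<le> d")
        case True
        then show ?thesis using m by (simp add: in_totatives_iff)
      next
        case False
        then have "coprime (m - d) d" using m
          by (metis (no_types, lifting) add.commute coprime_iff_gcd_eq_1 gcd_add1 le_add_diff_inverse2 mem_Collect_eq nat_le_linear)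
        then have "m - d \<in> ?C (N - d)" using m False by auto
        moreover have "m = (m - d) + d" using False by simp
        ultimately show ?thesis by blast
      qed
    qed (use False in \<open>auto simp: in_totatives_iff coprime_iff_gcd_eq_1\<close>)
    moreover have "totatives d \<inter> (\<lambda>m. m + d) ` ?C (N - d) = {}"
      by (auto simp: in_totatives_iff)
    ultimately have "card (?C N) = totient d + card (?C (N - d))"
      by (simp add: card_Un_disjoint card_image totient_def)
    moreover have "real N = real (N - d) + d" using False by simp
    ultimately show ?thesis using less.IH[of "N - d"] False assms by (simp add: algebra_simps)
  qed
qed

text \<open>There are two errors of at most \<open>d ^ 3\<close>: one from counting the numbers up
  to \<open>N div d\<close> coprime to \<open>d\<close>, the other from replacing
  \<open>d * (N div d)\<close> by \<open>N\<close>.\<close>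

lemma udvd_count_approx:
  assumes "0 < d"
  shows "\<bar>real (udvd_count N d) * real d ^ 2 - real N * totient d\<bar> \<le> 2 * real d ^ 3"
proof -
  let ?q = "N div d"
  have "\<bar>real (udvd_count N d) * d - real ?q * totient d\<bar> \<le> real d * d"
    using card_coprime_approx[OF assms] udvd_count_eq[OF assms] by simp
  then have "\<bar>real (udvd_count N d) * d - real ?q * totient d\<bar> * d \<le> (real d * d) * d"
    by (rule mult_right_mono) simp
  moreover have "real (udvd_count N d) * real d ^ 2 - real ?q * d * totient d
      = (real (udvd_count N d) * d - real ?q * totient d) * d"
    by (simp add: algebra_simps power2_eq_square)
  ultimately have 1: "\<bar>real (udvd_count N d) * real d ^ 2 - real ?q * d * totient d\<bar> \<le> real d ^ 3"
    by (simp only: abs_mult abs_of_nat power3_eq_cube)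
  have "real N = real ?q * d + real (N mod d)"
    by (metis div_mult_mod_eq of_nat_add of_nat_mult)
  then have "\<bar>real ?q * d * totient d - real N * totient d\<bar> = real (N mod d) * totient d"
    by (simp add: algebra_simps)
  also have "\<dots> \<le> real d * d" using assms totient_le[of d] by (intro mult_mono) auto
  also have "\<dots> \<le> real d ^ 3" using assms by (simp add: power3_eq_cube)
  finally show ?thesis using 1 by linarith
qed

lemma udvd_count_tendsto:
  "((\<lambda>x. real (udvd_count (nat \<lfloor>x\<rfloor>) d) / x) \<longlongrightarrow> real (totient d) / real d ^ 2) at_top"
proof (cases "d = 0")
  \<comment> \<open>At \<open>d = 0\<close> the count is zero, and so is the limit, since division
    by zero yields 0.\<close>
  case True
  then show ?thesis by (simp add: udvd_count_eq_0)
next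
  case False
  \<comment> \<open>The extra summand \<open>d\<close> pays for replacing the floor of
    \<open>x\<close> by \<open>x\<close>, a change of at most 1 multiplied by
    \<open>totient d\<close>.\<close>
  let ?D = "2 * real d ^ 3 + d"
  have "((\<lambda>x. real (udvd_count (nat \<lfloor>x\<rfloor>) d) / x - real (totient d) / real d ^ 2) \<longlongrightarrow> 0) at_top"
  proof (rule Lim_null_comparison)
    show "((\<lambda>x::real. ?D / real d ^ 2 / x) \<longlongrightarrow> 0) at_top"
      by (intro tendsto_divide_0[OF tendsto_const] filterlim_at_top_imp_at_infinity filterlim_ident)
    show "\<forall>\<^sub>F x in at_top. norm (real (udvd_count (nat \<lfloor>x\<rfloor>) d) / x - real (totient d) / real d ^ 2)
        \<le> ?D / real d ^ 2 / x"
      using eventually_gt_at_top[of 0]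
    proof eventually_elim
      case (elim x)
      let ?N = "nat \<lfloor>x\<rfloor>"
      have "\<bar>real ?N - x\<bar> \<le> 1" using elim by linarith
      then have "\<bar>real ?N - x\<bar> * totient d \<le> 1 * real d"
        using totient_le[of d] by (intro mult_mono) auto
      moreover have "real ?N * totient d - x * totient d = (real ?N - x) * totient d"
        by (simp add: algebra_simps)
      ultimately have "\<bar>real ?N * totient d - x * totient d\<bar> \<le> d"
        by (simp only: abs_mult abs_of_nat mult_1)
      then have "\<bar>real (udvd_count ?N d) * real d ^ 2 - x * totient d\<bar> \<le> ?D"
        using udvd_count_approx[of d ?N] False by linarith
      then have "\<bar>real (udvd_count ?N d) * real d ^ 2 - x * totient d\<bar> / (real d ^ 2 * x) \<le> ?D / (real d ^ 2 * x)"
        using elim by (intro divide_right_mono) auto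
      moreover have "real (udvd_count ?N d) / x - real (totient d) / real d ^ 2
          = (real (udvd_count ?N d) * real d ^ 2 - x * totient d) / (real d ^ 2 * x)"
        using elim False by (simp add: field_simps)
      ultimately show ?case using elim by (simp add: abs_mult abs_divide)
    qed
  qed
  then show ?thesis by (simp add: LIM_zero_iff)
qed

section \<open>Growth of \<open>mu_star\<close>\<close>

lemma card_divisors_le:
  fixes n :: nat
  assumes "0 < n"
  shows "real (card {d. d dvd n}) \<le> 2 * sqrt n"
proof -
  let ?s = "floor_sqrt n"
  \<comment> \<open>Of two complementary divisors the smaller is at most the square root, so every
    divisor is small or the complement of a small one.\<close>
  have "{d. d dvd n} \<subseteq> {1..?s} \<union> (\<lambda>e. n div e) ` {1..?s}"
  proof
    fix d assume "d \<in> {d. d dvd n}"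
    then obtain e where e: "n = d * e" by (auto elim: dvdE)
    then have pos: "0 < d" "0 < e" using assms by auto
    show "d \<in> {1..?s} \<union> (\<lambda>e. n div e) ` {1..?s}"
    proof (cases "d \<le> e")
      case True
      then have "d \<in> {1..?s}" using pos e by (simp add: le_floor_sqrt_iff power2_eq_square)
      then show ?thesis by simp
    next
      case False
      then have "e \<in> {1..?s}" using pos e by (simp add: le_floor_sqrt_iff power2_eq_square)
      moreover have "d = n div e" using e pos by simp
      ultimately show ?thesis by blast
    qed
  qed
  then have "card {d. d dvd n} \<le> card ({1..?s} \<union> (\<lambda>e. n div e) ` {1..?s})"
    by (rule card_mono[rotated]) simp
  also have "\<dots> \<le> card {1..?s} + card ((\<lambda>e. n div e) ` {1..?s})" by (rule card_Un_le)
  also have "\<dots> \<le> ?s + ?s" using card_image_le[of "{1..?s}" "\<lambda>e. n div e"] by simp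
  finally have "real (card {d. d dvd n}) \<le> 2 * real ?s" by linarith
  moreover have "real ?s \<le> sqrt n"
    by (rule real_le_rsqrt) (metis floor_sqrt_power2_le of_nat_le_iff of_nat_power)
  ultimately show ?thesis by linarith
qed

lemma abs_mu_star_le:
  assumes "0 < n"
  shows "\<bar>mu_star S n\<bar> \<le> 2 * sqrt n"
proof -
  have "\<bar>mu_star S n\<bar> \<le> (\<Sum>d | d udvd n. \<bar>char_fun S d * (-1) ^ omega (n div d)\<bar>)"
    unfolding mu_star_def by (rule sum_abs)
  also have "\<dots> \<le> (\<Sum>d | d udvd n. 1)"
    by (rule sum_mono) (simp add: char_fun_def abs_mult power_abs)
  also have "\<dots> \<le> real (card {d. d dvd n})"
    using assms by (simp, intro card_mono) (auto simp: unitary_dvd_def)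
  also have "\<dots> \<le> 2 * sqrt n" using assms by (rule card_divisors_le)
  finally show ?thesis .
qed

section \<open>Euler products\<close>

text \<open>The bound on the primes is strict, to match products over \<open>p < N\<close>: the set
  for \<open>N = 0\<close> is \<open>{1}\<close>, in line with the empty product.\<close>

definition smooth_nats :: "nat \<Rightarrow> nat set"
  where "smooth_nats N = {n. 0 < n \<and> (\<forall>p. prime p \<longrightarrow> p dvd n \<longrightarrow> p < N)}"

lemma smooth_nats_0: "smooth_nats 0 = {1}"
proof -
  have "n = 1" if "\<forall>p. prime p \<longrightarrow> \<not> p dvd n" for n :: nat
    using that prime_factor_nat by blast
  then show ?thesis by (auto simp: smooth_nats_def)
qed

lemma smooth_nats_Suc_not_prime:
  assumes "\<not> prime p"
  shows "smooth_nats (Suc p) = smooth_nats p"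
  using assms by (auto simp: smooth_nats_def less_Suc_eq)

text \<open>Unique factorization: split off the exact power of \<open>p\<close>. Sums over the
  larger set thereby become double sums over the exponent and the part free of
  \<open>p\<close>.\<close>

lemma bij_betw_smooth_nats_Suc:
  assumes p: "prime p"
  shows "bij_betw (\<lambda>(a :: nat, m). p ^ a * m) (UNIV \<times> smooth_nats p) (smooth_nats (Suc p))"
proof (rule bij_betwI[where g = "\<lambda>n. (multiplicity p n, n div p ^ multiplicity p n)"])
  have p0: "0 < p" using p by (rule prime_gt_0_nat)
  show "(\<lambda>(a :: nat, m). p ^ a * m) \<in> UNIV \<times> smooth_nats p \<rightarrow> smooth_nats (Suc p)"
  proof (clarsimp simp: smooth_nats_def p0)
    fix a m q assume m: "\<forall>q. prime q \<longrightarrow> q dvd m \<longrightarrow> q < p" and q: "prime q" "q dvd p ^ a * m"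
    then have "q dvd p ^ a \<or> q dvd m" by (simp add: prime_dvd_mult_iff)
    then show "q < Suc p"
    proof
      assume "q dvd p ^ a"
      then have "q = p" using p q(1) prime_dvd_power primes_dvd_imp_eq by blast
      then show ?thesis by simp
    next
      assume "q dvd m"
      then show ?thesis using m q(1) less_SucI by blast
    qed
  qed
  show "(\<lambda>n. (multiplicity p n, n div p ^ multiplicity p n)) \<in> smooth_nats (Suc p) \<rightarrow> UNIV \<times> smooth_nats p"
  proof
    fix n assume n: "n \<in> smooth_nats (Suc p)"
    obtain r where r: "n = p ^ multiplicity p n * r" "\<not> p dvd r"
    proof (rule multiplicity_decompose'[of n p])
      show "n \<noteq> 0" using n by (simp add: smooth_nats_def)
      show "\<not> is_unit p" using p not_prime_unit by blast
    qed
    then have r0: "0 < r" using n by (cases "r = 0") (auto simp: smooth_nats_def)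
    have "n div p ^ multiplicity p n = r"
      by (subst (1) r(1)) (simp add: p0)
    moreover have "q < p" if q: "prime q" "q dvd r" for q
    proof -
      have "q dvd n" using q(2) r(1) by (metis dvd_mult)
      then have "q < Suc p" using n q(1) by (auto simp: smooth_nats_def)
      moreover have "q \<noteq> p" using q r by blast
      ultimately show ?thesis by simp
    qed
    ultimately show "(multiplicity p n, n div p ^ multiplicity p n) \<in> UNIV \<times> smooth_nats p"
      using r0 by (simp add: smooth_nats_def)
  qed
  show "(case (multiplicity p n, n div p ^ multiplicity p n) of (a, m) \<Rightarrow> p ^ a * m) = n" for n
    by (simp add: multiplicity_dvd)
  fix x :: "nat \<times> nat" assume x: "x \<in> UNIV \<times> smooth_nats p"
  then obtain a m where am: "x = (a, m)" "m \<in> smooth_nats p" by auto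
  then have "\<not> p dvd m" using p by (auto simp: smooth_nats_def)
  then have "\<not> p ^ Suc a dvd p ^ a * m" using p0 by (simp add: power_Suc2 del: power_Suc)
  then have "multiplicity p (p ^ a * m) = a" by (intro multiplicity_eqI) auto
  then show "(multiplicity p (case x of (a, m) \<Rightarrow> p ^ a * m),
      (case x of (a, m) \<Rightarrow> p ^ a * m) div p ^ multiplicity p (case x of (a, m) \<Rightarrow> p ^ a * m)) = x"
    using am p0 by simp
qed

context
  fixes f :: "nat \<Rightarrow> real"
  assumes f_0: "f 0 = 0" and f_1: "f 1 = 1"
    and f_mult: "\<And>m n. coprime m n \<Longrightarrow> f (m * n) = f m * f n"
    and f_summable: "summable (\<lambda>n. \<bar>f n\<bar>)"
begin

text \<open>The value 1 off the primes lets a product over primes be indexed by all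
  naturals.\<close>

definition euler_factor :: "nat \<Rightarrow> real"
  where "euler_factor p = (if prime p then \<Sum>a. f (p ^ a) else 1)"

lemma abs_f_summable_on: "(\<lambda>n. \<bar>f n\<bar>) summable_on A"
proof -
  have "(\<lambda>n. \<bar>f n\<bar>) summable_on UNIV"
    using f_summable by (intro norm_summable_imp_summable_on) simp
  then show ?thesis by (rule summable_on_subset_banach) simp
qed

lemma f_summable_on: "f summable_on A"
  by (rule abs_summable_summable) (simp add: abs_f_summable_on)

lemma has_sum_smooth_nats: "(f has_sum (\<Prod>p<N. euler_factor p)) (smooth_nats N)"
proof (induction N)
  case 0
  then show ?case using has_sum_finite[of "{1}" f] by (simp add: smooth_nats_0 f_1[simplified])
next
  case (Suc p)
  show ?case
  proof (cases "prime p")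
    case False
    then show ?thesis using Suc by (simp add: smooth_nats_Suc_not_prime euler_factor_def)
  next
    case True
    let ?P = "\<Prod>p<p. euler_factor p"
    let ?h = "\<lambda>(a, m). p ^ a * m"
    note bij = bij_betw_smooth_nats_Suc[OF True]
    have eq: "f (?h (a, m)) = f (p ^ a) * f m" if "m \<in> smooth_nats p" for a m
    proof -
      have "\<not> p dvd m" using that True by (auto simp: smooth_nats_def)
      then show ?thesis using True by (simp add: f_mult prime_imp_coprime)
    qed
    have inj: "inj (\<lambda>a. p ^ a)" using True by (auto simp: inj_on_def prime_gt_Suc_0_nat)
    \<comment> \<open>The powers of \<open>p\<close> form a subfamily of the summable family
      \<open>f\<close>. The unordered sum obtained here agrees with the ordered series in
      \<open>euler_factor\<close>.\<close>
    have "(\<lambda>a. f (p ^ a)) summable_on UNIV"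
      using f_summable_on[of "range (\<lambda>a. p ^ a)"] summable_on_reindex[OF inj, of f] by (simp add: o_def)
    then have "((\<lambda>a. f (p ^ a)) has_sum (\<Sum>\<^sub>\<infinity>a. f (p ^ a))) UNIV" by (rule has_sum_infsum)
    moreover from has_sum_imp_sums[OF this] have "(\<Sum>\<^sub>\<infinity>a. f (p ^ a)) = euler_factor p"
      using True by (simp add: euler_factor_def sums_iff)
    ultimately have G: "((\<lambda>a. f (p ^ a)) has_sum euler_factor p) UNIV" by simp
    have "((\<lambda>x. f (?h x)) has_sum (euler_factor p * ?P)) (UNIV \<times> smooth_nats p)"
    proof (rule has_sum_SigmaI)
      show "((\<lambda>m. f (?h (a, m))) has_sum (f (p ^ a) * ?P)) (smooth_nats p)" for a
        using has_sum_cmult_right[OF Suc, of "f (p ^ a)"] by (subst has_sum_cong[OF eq]) auto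
      show "((\<lambda>a. f (p ^ a) * ?P) has_sum (euler_factor p * ?P)) UNIV"
        by (rule has_sum_cmult_left[OF G])
      \<comment> \<open>Joint summability, which turns the iterated sum into a sum over pairs, is
        transported along the bijection.\<close>
      show "(\<lambda>x. f (?h x)) summable_on (UNIV \<times> smooth_nats p)"
        using f_summable_on by (rule summable_on_reindex_bij_betw[OF bij, THEN iffD2])
    qed
    then show ?thesis using has_sum_reindex_bij_betw[OF bij, of f] by (simp add: mult.commute)
  qed
qed

text \<open>Tannery's theorem with dominating series \<open>\<bar>f n\<bar>\<close>: each positive
  \<open>n\<close> lies in \<open>smooth_nats N\<close> once \<open>N > n\<close>, while 0 never
  does and contributes \<open>f 0 = 0\<close>.\<close>

lemma euler_product_tendsto: "(\<lambda>N. \<Prod>p<N. euler_factor p) \<longlonglongrightarrow> suminf f"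
proof -
  let ?a = "\<lambda>n N. if n \<in> smooth_nats N then f n else 0"
  have "(\<lambda>N. \<Sum>n. ?a n N) \<longlonglongrightarrow> suminf f"
  proof (rule tannerys_theorem[THEN conjunct2, THEN conjunct2])
    fix n
    have "\<forall>\<^sub>F N in sequentially. ?a n N = f n"
      using eventually_gt_at_top[of n]
    proof eventually_elim
      case (elim N)
      then show ?case using f_0 by (cases "n = 0") (auto simp: smooth_nats_def dest!: dvd_imp_le)
    qed
    then show "(\<lambda>N. ?a n N) \<longlonglongrightarrow> f n" by (rule tendsto_eventually)
    show "\<forall>\<^sub>F (n, N) in at_top \<times>\<^sub>F sequentially. norm (?a n N) \<le> \<bar>f n\<bar>"
      by (rule always_eventually) auto
  qed (use f_summable in auto)
  moreover have "(\<Sum>n. ?a n N) = (\<Prod>p<N. euler_factor p)" for N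
  proof -
    have "((\<lambda>n. ?a n N) has_sum (\<Prod>p<N. euler_factor p)) UNIV"
      using has_sum_smooth_nats[of N] by (subst has_sum_cong_neutral[where S = UNIV and T = "smooth_nats N" and g = f]) auto
    then show ?thesis by (rule sums_unique[OF has_sum_imp_sums, symmetric])
  qed
  ultimately show ?thesis by simp
qed

text \<open>An Euler factor minus 1 is the sum of \<open>f\<close> over the powers of
  \<open>p\<close> with positive exponent. Over all primes these powers are distinct, so everything
  is bounded by a subfamily of the absolutely summable \<open>f\<close>.\<close>

lemma summable_euler_factor: "summable (\<lambda>p. \<bar>euler_factor p - 1\<bar>)"
proof -
  \<comment> \<open>Exponent 0 is excluded: it gives 1 for every prime and would destroy
    injectivity.\<close>
  let ?h = "\<lambda>(p::nat, a). p ^ Suc a"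
  let ?P = "{p::nat. prime p}"
  have inj: "inj_on ?h (?P \<times> UNIV)"
  proof (rule inj_onI, clarify)
    fix p q a b :: nat assume pq: "prime p" "prime q" and eq: "p ^ Suc a = q ^ Suc b"
    have "p = q" using prime_power_eq_imp_eq[OF pq _ eq] by simp
    moreover have "Suc a = Suc b" using eq pq calculation by (metis power_inject_exp prime_gt_1_nat)
    ultimately show "p = q \<and> a = b" by simp
  qed
  have S: "(\<lambda>x. \<bar>f (?h x)\<bar>) summable_on (?P \<times> UNIV)"
    using abs_f_summable_on[of "?h ` (?P \<times> UNIV)"] summable_on_reindex[OF inj, of "\<lambda>n. \<bar>f n\<bar>"]
    unfolding o_def by blast
  then have S': "(\<lambda>p. \<Sum>\<^sub>\<infinity>a. \<bar>f (p ^ Suc a)\<bar>) summable_on ?P"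
    using summable_on_Sigma_banach[of "\<lambda>p a. \<bar>f (p ^ Suc a)\<bar>" ?P "\<lambda>_. UNIV"] by (simp add: case_prod_unfold)
  have "(\<lambda>p. \<bar>euler_factor p - 1\<bar>) summable_on ?P"
  proof (rule summable_on_comparison_test[OF S'])
    fix p assume p: "p \<in> ?P"
    have "(\<lambda>a. \<bar>f (p ^ Suc a)\<bar>) summable_on UNIV"
      using summable_on_SigmaD1[of "\<lambda>p a. \<bar>f (p ^ Suc a)\<bar>" ?P "\<lambda>_. UNIV" p] S p by (simp add: case_prod_unfold)
    then have *: "(\<lambda>a. \<bar>f (p ^ Suc a)\<bar>) sums (\<Sum>\<^sub>\<infinity>a. \<bar>f (p ^ Suc a)\<bar>)"
      using has_sum_imp_sums has_sum_infsum by blast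
    then have sm: "summable (\<lambda>a. \<bar>f (p ^ Suc a)\<bar>)" by (simp add: sums_iff)
    then have "summable (\<lambda>a. f (p ^ Suc a))" by (rule summable_rabs_cancel)
    then have "summable (\<lambda>a. f (p ^ a))" by (subst (asm) summable_Suc_iff)
    then have "(\<Sum>a. f (p ^ a)) - 1 = (\<Sum>a. f (p ^ Suc a))"
      using suminf_split_head[of "\<lambda>a. f (p ^ a)"] f_1 by simp
    then have "\<bar>euler_factor p - 1\<bar> = \<bar>\<Sum>a. f (p ^ Suc a)\<bar>"
      using p by (simp add: euler_factor_def)
    also have "\<dots> \<le> (\<Sum>a. \<bar>f (p ^ Suc a)\<bar>)" using sm by (rule summable_rabs)
    also have "\<dots> = (\<Sum>\<^sub>\<infinity>a. \<bar>f (p ^ Suc a)\<bar>)" using * by (simp add: sums_iff)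
    finally show "\<bar>euler_factor p - 1\<bar> \<le> (\<Sum>\<^sub>\<infinity>a. \<bar>f (p ^ Suc a)\<bar>)" .
  qed simp
  then have "(\<lambda>p. \<bar>euler_factor p - 1\<bar>) summable_on UNIV"
    by (rule summable_on_cong_neutral[THEN iffD1, rotated -1]) (auto simp: euler_factor_def)
  then show ?thesis by (rule summable_on_imp_summable)
qed

text \<open>\<open>has_prod\<close> demands a nonzero limit once any zero factors are dropped, so
  convergence of the partial products is not enough. Absolute convergence of the product supplies
  this, and the limit of the partial products then identifies the value.\<close>

theorem euler_product: "(\<lambda>p. if prime p then \<Sum>a. f (p ^ a) else 1) has_prod suminf f"
proof -
  have conv: "convergent_prod euler_factor"
    using summable_euler_factor
    by (intro abs_convergent_prod_imp_convergent_prod summable_imp_abs_convergent_prod) simp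
  have "(\<lambda>N. \<Prod>p<Suc N. euler_factor p) \<longlonglongrightarrow> prodinf euler_factor"
    using convergent_prod_LIMSEQ[OF conv] by (simp add: lessThan_Suc_atMost)
  moreover have "(\<lambda>N. \<Prod>p<Suc N. euler_factor p) \<longlonglongrightarrow> suminf f"
    using euler_product_tendsto by (rule LIMSEQ_Suc)
  ultimately have "prodinf euler_factor = suminf f" by (rule LIMSEQ_unique)
  then show ?thesis using conv unfolding has_prod_iff euler_factor_def by simp
qed

end

section \<open>Densities\<close>

text \<open>Here \<open>t\<close> stands for the ratio u(x,d)/x or its limit. As \<open>t\<close> is
  at most 1, the exponent 2 is the worst case, leaving 2 sqrt(d) / d^2.\<close>

lemma abs_mu_star_mult_power_le:
  assumes "0 \<le> t" "t \<le> 1 / real d" "2 \<le> k" "0 < d"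
  shows "\<bar>mu_star S d * t ^ k\<bar> \<le> 2 * real d powr (- 3 / 2)"
proof -
  have "t ^ k \<le> (1 / real d) ^ k" using assms by (intro power_mono) auto
  also have "\<dots> \<le> (1 / real d) ^ 2" using assms by (intro power_decreasing) auto
  finally have "\<bar>mu_star S d\<bar> * t ^ k \<le> (2 * sqrt d) * (1 / real d) ^ 2"
    using abs_mu_star_le[OF assms(4)] assms by (intro mult_mono) auto
  also have "(2 * sqrt d) * (1 / real d) ^ 2 = 2 * (real d powr (1 / 2) * real d powr (- 2))"
    using assms by (simp add: powr_half_sqrt powr_minus powr_numeral field_simps)
  also have "\<dots> = 2 * real d powr (- 3 / 2)" by (simp flip: powr_add)
  finally show ?thesis using assms by (simp add: abs_mult)
qed

lemma tuples_le_eq: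
  assumes "0 \<le> x"
  shows "{ns \<in> {ns \<in> pos_tuples k. P ns} \<inter> pos_tuples k. \<forall>n\<in>set ns. real n \<le> x}
    = {ns. set ns \<subseteq> {1..nat \<lfloor>x\<rfloor>} \<and> length ns = k \<and> P ns}"
proof -
  have "real n \<le> x \<longleftrightarrow> n \<le> nat \<lfloor>x\<rfloor>" for n using assms by (simp add: le_nat_iff le_floor_iff)
  then show ?thesis by (auto simp: pos_tuples_def subset_iff Suc_le_eq)
qed

lemma gcud_density:
  fixes S :: "nat set"
  assumes k: "2 \<le> k"
  defines "g \<equiv> \<lambda>d. mu_star S d * (real (totient d) / real d ^ 2) ^ k"
  shows "summable (\<lambda>d. \<bar>g d\<bar>)"
    and "has_asymp_density k {ns \<in> pos_tuples k. gcud ns \<in> S} (suminf g)"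
proof -
  let ?a = "\<lambda>d x. mu_star S d * (real (udvd_count (nat \<lfloor>x\<rfloor>) d) / x) ^ k"
  let ?M = "\<lambda>d. 2 * real d powr (- 3 / 2)"
  have lim: "((\<lambda>x. ?a d x) \<longlongrightarrow> g d) at_top" for d
    unfolding g_def by (intro tendsto_intros udvd_count_tendsto)
  have bound: "norm (?a d x) \<le> ?M d" if "1 \<le> x" for d x
  proof (cases "d = 0")
    \<comment> \<open>At \<open>d = 0\<close> both sides are zero, because the count vanishes and
      \<open>0 powr\<close> anything is 0.\<close>
    case True
    then show ?thesis using k by (simp add: udvd_count_eq_0)
  next
    case False
    have "real (udvd_count (nat \<lfloor>x\<rfloor>) d) * real d \<le> x"
      using udvd_count_le[of "nat \<lfloor>x\<rfloor>" d] that by linarith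
    then have "real (udvd_count (nat \<lfloor>x\<rfloor>) d) / x \<le> 1 / real d"
      using that False by (simp add: field_simps)
    then show ?thesis using abs_mu_star_mult_power_le[of _ d k S] that k False by simp
  qed
  have "\<forall>\<^sub>F (d, x) in at_top \<times>\<^sub>F at_top. norm (?a d x) \<le> ?M d"
    using eventually_prodI[OF eventually_True eventually_ge_at_top[of "1::real"], of at_top]
    by eventually_elim (use bound in auto)
  moreover have "summable ?M"
    by (intro summable_mult) (simp add: summable_real_powr_iff)
  ultimately have T: "summable (\<lambda>d. norm (g d))" "((\<lambda>x. \<Sum>d. ?a d x) \<longlongrightarrow> suminf g) at_top"
    using tannerys_theorem[of ?a g at_top ?M, OF lim] by auto
  show "summable (\<lambda>d. \<bar>g d\<bar>)" using T(1) by simp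
  have "\<forall>\<^sub>F x in at_top. (\<Sum>d. ?a d x)
      = real (card {ns \<in> {ns \<in> pos_tuples k. gcud ns \<in> S} \<inter> pos_tuples k. \<forall>n\<in>set ns. real n \<le> x}) / x ^ k"
    using eventually_ge_at_top[of 1]
  proof eventually_elim
    case (elim x)
    let ?N = "nat \<lfloor>x\<rfloor>"
    \<comment> \<open>For each \<open>x\<close> the series is a finite sum, because no positive
      integer up to \<open>?N\<close> has 0 or a number above \<open>?N\<close> as a unitary
      divisor.\<close>
    have "(\<Sum>d. ?a d x) = (\<Sum>d\<in>{1..?N}. ?a d x)"
    proof (rule suminf_finite)
      fix d assume "d \<notin> {1..?N}"
      then have "udvd_count ?N d = 0" by (intro udvd_count_eq_0) auto
      then show "?a d x = 0" using k by simp
    qed simp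
    also have "\<dots> = (\<Sum>d\<in>{1..?N}. mu_star S d * real (udvd_count ?N d) ^ k) / x ^ k"
      by (simp add: sum_divide_distrib power_divide)
    also have "\<dots> = real (card {ns. set ns \<subseteq> {1..?N} \<and> length ns = k \<and> gcud ns \<in> S}) / x ^ k"
      using k card_gcud_mem[of k ?N S] by simp
    finally show ?case using elim by (subst tuples_le_eq) auto
  qed
  then show "has_asymp_density k {ns \<in> pos_tuples k. gcud ns \<in> S} (suminf g)"
    unfolding has_asymp_density_def using T(2) by (rule Lim_transform_eventually[rotated])
qed

section \<open>The case \<open>S = {1}\<close> and its Euler factors\<close>

text \<open>Only the divisor 1 survives in the defining sum. The result is the unitary analogue of
  the Moebius function.\<close>

lemma mu_star_1:
  assumes "0 < n"
  shows "mu_star {1} n = (-1) ^ omega n"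
proof -
  have "mu_star {1} n = (\<Sum>d | d udvd n. if d = 1 then (-1) ^ omega n else 0)"
    unfolding mu_star_def by (rule sum.cong) (auto simp: char_fun_def)
  also have "\<dots> = (-1) ^ omega n"
    using finite_udvd[OF assms] by (simp add: sum.delta' unitary_dvd_def)
  finally show ?thesis .
qed

lemma omega_mult_coprime:
  assumes "coprime m n" "0 < m" "0 < n"
  shows "omega (m * n) = omega m + omega n"
proof -
  have "prime_factors m \<inter> prime_factors n = {}"
    using assms(1) by (auto simp: in_prime_factors_iff) (metis coprime_common_divisor not_prime_unit)
  then show ?thesis
    using assms(2,3) by (simp add: omega_def prime_factors_product card_Un_disjoint)
qed

text \<open>After the leading term 1 the series is geometric with ratio \<open>1 / p ^ k\<close>:
  \<open>omega\<close> is 1 at every higher power of \<open>p\<close>, and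
  \<open>totient (p ^ Suc a)\<close> is \<open>p ^ a * (p - 1)\<close>.\<close>

lemma sums_mu_star_1_prime_powers:
  fixes p k :: nat
  assumes "prime p" "0 < k"
  shows "(\<lambda>a. mu_star {1} (p ^ a) * (real (totient (p ^ a)) / real (p ^ a) ^ 2) ^ k)
    sums (1 - (real p - 1) ^ k / (real p ^ k * (real p ^ k - 1)))" (is "?f sums _")
proof -
  have p: "1 < p" using assms(1) by (rule prime_gt_1_nat)
  have pk: "1 < real p ^ k" using p assms(2) by (intro one_less_power) auto
  have Suc: "?f (Suc a) = - (((real p - 1) / real p ^ 2) ^ k) * (1 / real p ^ k) ^ a" for a
  proof -
    have "omega (p ^ Suc a) = 1"
      using omega_prime_power_mult[OF assms(1), of 1 "Suc a"] p by (simp add: omega_def)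
    then have "mu_star {1} (p ^ Suc a) = - 1" using mu_star_1[of "p ^ Suc a"] p by simp
    moreover have "real (totient (p ^ Suc a)) / real (p ^ Suc a) ^ 2
        = (real p - 1) / real p ^ 2 * (1 / real p) ^ a"
      using p by (simp add: totient_prime_power_Suc[OF assms(1)] of_nat_diff field_simps power2_eq_square del: power_Suc) (simp add: field_simps)
    ultimately show ?thesis
      by (simp only: power_mult_distrib power_divide power_one flip: power_mult) (simp add: mult.commute)
  qed
  have "(\<lambda>a. (1 / real p ^ k) ^ a) sums (1 / (1 - 1 / real p ^ k))"
    using pk by (intro geometric_sums) (simp add: divide_less_eq)
  then have "(\<lambda>a. ?f (Suc a)) sums (- (((real p - 1) / real p ^ 2) ^ k) * (1 / (1 - 1 / real p ^ k)))"
    unfolding Suc by (rule sums_mult)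
  then have "?f sums (- (((real p - 1) / real p ^ 2) ^ k) * (1 / (1 - 1 / real p ^ k)) + ?f 0)"
    by (rule sums_Suc)
  moreover have "?f 0 = 1" using mu_star_1[of 1] by (simp add: omega_def)
  moreover have "((real p - 1) / real p ^ 2) ^ k * (1 / (1 - 1 / real p ^ k))
      = (real p - 1) ^ k / (real p ^ k * (real p ^ k - 1))"
  proof -
    have "1 / (1 - 1 / real p ^ k) = real p ^ k / (real p ^ k - 1)"
      using pk p by (simp add: field_simps)
    moreover have "(real p ^ 2) ^ k = real p ^ k * real p ^ k"
      by (simp add: power2_eq_square power_mult_distrib)
    ultimately show ?thesis using pk by (simp add: power_divide)
  qed
  ultimately show ?thesis by simp
qed

theorem theorem2p2:
  fixes k :: nat and S :: "nat set"
  assumes "k \<ge> 2" and "S \<subseteq> {0<..}"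
  shows "(\<exists>\<delta>::real.
            (\<lambda>m. mu_star S (Suc m) * real (totient (Suc m)) ^ k / real (Suc m) ^ (2 * k)) sums \<delta> \<and>
            has_asymp_density k {ns \<in> pos_tuples k. gcud ns \<in> S} \<delta>) \<and>
         (\<exists>\<delta>::real.
            (\<lambda>p. if prime p then 1 - (real p - 1) ^ k / (real p ^ k * (real p ^ k - 1)) else 1) has_prod \<delta> \<and>
            has_asymp_density k {ns \<in> pos_tuples k. gcud ns = 1} \<delta>)"
proof
  have k: "0 < k" using assms(1) by simp
  define g where "g S d = mu_star S d * (real (totient d) / real d ^ 2) ^ k" for S d
  have g_0: "g S 0 = 0" for S using k by (simp add: g_def)
  note dens = gcud_density[OF assms(1), folded g_def]
  have "g S sums suminf (g S)"
    using dens(1)[of S] by (intro summable_sums) (rule summable_rabs_cancel)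
  \<comment> \<open>The shift drops the term at 0, which is zero, so the series runs over the
    positive integers.\<close>
  then have "(\<lambda>m. g S (Suc m)) sums suminf (g S)" by (simp add: sums_Suc_iff g_0)
  moreover have "g S (Suc m) = mu_star S (Suc m) * real (totient (Suc m)) ^ k / real (Suc m) ^ (2 * k)" for m
    by (simp add: g_def power_divide power_mult)
  ultimately show "\<exists>\<delta>::real.
      (\<lambda>m. mu_star S (Suc m) * real (totient (Suc m)) ^ k / real (Suc m) ^ (2 * k)) sums \<delta> \<and>
      has_asymp_density k {ns \<in> pos_tuples k. gcud ns \<in> S} \<delta>"
    using dens(2)[of S] by auto
  have "(\<lambda>p. if prime p then \<Sum>a. g {1} (p ^ a) else 1) has_prod suminf (g {1})"
  proof (rule euler_product)
    show g_1: "g {1} 1 = 1" using mu_star_1[of 1] by (simp add: g_def omega_def)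
    fix m n :: nat assume mn: "coprime m n"
    show "g {1} (m * n) = g {1} m * g {1} n"
    proof (cases "m = 0 \<or> n = 0")
      case True
      then show ?thesis using g_0 by auto
    next
      case False
      then show ?thesis using mn
        by (simp add: g_def mu_star_1[simplified] omega_mult_coprime totient_mult_coprime power_add
            power_mult_distrib power_divide)
    qed
  qed (use g_0 dens(1) in auto)
  moreover have "(\<Sum>a. g {1} (p ^ a)) = 1 - (real p - 1) ^ k / (real p ^ k * (real p ^ k - 1))" if "prime p" for p
    using sums_unique[OF sums_mu_star_1_prime_powers[OF that k]] unfolding g_def by simp
  ultimately have "(\<lambda>p. if prime p then 1 - (real p - 1) ^ k / (real p ^ k * (real p ^ k - 1)) else 1)
      has_prod suminf (g {1})"
    by (simp cong: if_cong)
  then show "\<exists>\<delta>::real.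
      (\<lambda>p. if prime p then 1 - (real p - 1) ^ k / (real p ^ k * (real p ^ k - 1)) else 1) has_prod \<delta> \<and>
      has_asymp_density k {ns \<in> pos_tuples k. gcud ns = 1} \<delta>"
    using dens(2)[of "{1}"] by auto
qed

end
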